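(* Fix a positive integer $d$. For $p\in[\frac12,1]$ and $q:=1-p$, let $(S_n)_{n\ge 0}$ be the simple random walk on $\mathbb{Z}$ with $S_0=0$ and mutually independent increments $X_n=S_n-S_{n-1}$ satisfying $\mathbb{P}[X_n=+1]=p$ and $\mathbb{P}[X_n=-1]=q$ for $n\ge 1$; let $R_n:=\#\{1\le k\le n: X_k=+1\}$ and $N_d:=\inf\{n\ge 0: S_n=d\}$. Then the function $$ p\mapsto \mathbb{E}\left[\frac{R_{N_d}}{N_d}\right] $$ is strictly increasing over $[\frac12,1]$; moreover, $$ \lim_{p\to 1}\mathbb{E}\left[\frac{R_{N_d}}{N_d}\right]=1 \quad\text{and}\quad \lim_{p\to 1}\operatorname{Var}\left[\frac{R_{N_d}}{N_d}\right]=0. $$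
   Context: The distribution of the walk, and hence the expectation and variance, depends on $p$; limits as $p\to 1$ are taken with $p<1$. For $p\ge \frac12$, the hitting time $N_d$ is almost surely finite, so $R_{N_d}/N_d$ is almost surely well defined (its value on the null event $\{N_d=\infty\}$ is irrelevant). $R_{N_d}$ denotes $R_n$ evaluated at $n=N_d$. *)

theory Defs
  imports "HOL-Probability.Probability" "HOL-Library.Extended_Nat"
begin

text \<open>The sample path is \<open>S n \<omega>\<close>. Independence and the laws concern the increments with index
  at least 1; the value of \<open>step\<close> at index 0 is never used.\<close>

definition step :: "(nat \<Rightarrow> 'a \<Rightarrow> int) \<Rightarrow> nat \<Rightarrow> 'a \<Rightarrow> int" where
  "step S n \<omega> = S n \<omega> - S (n - 1) \<omega>"

locale simple_random_walk = prob_space M for M :: "'a measure" +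
  fixes p :: real and S :: "nat \<Rightarrow> 'a \<Rightarrow> int"
  assumes start: "\<And>\<omega>. \<omega> \<in> space M \<Longrightarrow> S 0 \<omega> = 0"
    and indep_steps: "indep_vars (\<lambda>_. count_space UNIV) (step S) {1..}"
    and prob_up: "\<And>n. n \<ge> 1 \<Longrightarrow> prob {\<omega> \<in> space M. step S n \<omega> = 1} = p"
    and prob_down: "\<And>n. n \<ge> 1 \<Longrightarrow> prob {\<omega> \<in> space M. step S n \<omega> = - 1} = 1 - p"

definition right_steps :: "(nat \<Rightarrow> 'a \<Rightarrow> int) \<Rightarrow> nat \<Rightarrow> 'a \<Rightarrow> nat" where
  "right_steps S n \<omega> = card {k \<in> {1..n}. step S k \<omega> = 1}"

text \<open>The infimum of the empty set is \<open>\<infinity>\<close>.\<close>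

definition hitting_time :: "(nat \<Rightarrow> 'a \<Rightarrow> int) \<Rightarrow> nat \<Rightarrow> 'a \<Rightarrow> enat" where
  "hitting_time S d \<omega> = Inf (enat ` {n. S n \<omega> = int d})"

text \<open>The quotient \<open>R\<^sub>N / N\<close> at the hitting time \<open>N\<close> of \<open>d\<close>. The value 0 when \<open>d\<close> is never
  hit is arbitrary: for \<open>p \<ge> 1/2\<close> this is a null event.\<close>

definition right_ratio :: "(nat \<Rightarrow> 'a \<Rightarrow> int) \<Rightarrow> nat \<Rightarrow> 'a \<Rightarrow> real" where
  "right_ratio S d \<omega> =
     (case hitting_time S d \<omega> of
        enat n \<Rightarrow> real (right_steps S n \<omega>) / real n
      | \<infinity> \<Rightarrow> 0)"

end

theory Submission
  imports Defs
begin

text \<open>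
  Almost surely every step is \<open>\<plusminus>1\<close>, so \<open>d = 2 R\<^sub>N - N\<close> at the hitting time \<open>N\<close> of \<open>d\<close> and hence
  \<open>R\<^sub>N / N = 1/2 + d / (2 N)\<close>, a decreasing function of \<open>N\<close>. Conditioning on the first step gives a
  recursion for \<open>P(N \<le> n)\<close>; this probability is decreasing in \<open>d\<close>, so by the recursion it is
  increasing in \<open>p\<close>. Summation by parts writes \<open>E(R\<^sub>N / N)\<close> as a limit of combinations of the
  \<open>P(N \<le> n)\<close> with nonnegative coefficients; strictness comes from the term \<open>P(N \<le> d) = p^d\<close>.
  Both limits follow from \<open>p^d \<le> E(R\<^sub>N / N) \<le> 1\<close> and \<open>0 \<le> R\<^sub>N / N \<le> 1\<close>, the latter giving
  \<open>Var \<le> E - E^2\<close>.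
\<close>

section \<open>Hitting probabilities: the recursion and its monotonicity\<close>

text \<open>This is P(N \<le> n) for target \<open>d\<close>, by conditioning on the first step;
  \<open>prob_hits\<close> makes the link. As a plain function of \<open>p\<close> it lets walks on
  different probability spaces be compared.\<close>

fun hit_prob :: "real \<Rightarrow> nat \<Rightarrow> nat \<Rightarrow> real" where
  "hit_prob p n 0 = 1"
| "hit_prob p 0 (Suc d) = 0"
| "hit_prob p (Suc n) (Suc d) = p * hit_prob p n d + (1 - p) * hit_prob p n (Suc (Suc d))"

lemma hit_prob_le_1: "0 \<le> p \<Longrightarrow> p \<le> 1 \<Longrightarrow> hit_prob p n d \<le> 1"
proof (induction p n d rule: hit_prob.induct)
  case (3 p n d)
  then show ?case
    using convex_bound_le[of "hit_prob p n d" 1 "hit_prob p n (Suc (Suc d))" p "1 - p"] by simp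
qed auto

text \<open>In the recursive case both sides carry the same weights \<open>p\<close> and
  \<open>1 - p\<close>, so the induction hypotheses compare them term by term.\<close>

lemma hit_prob_Suc_le: "0 \<le> p \<Longrightarrow> p \<le> 1 \<Longrightarrow> hit_prob p n (Suc d) \<le> hit_prob p n d"
proof (induction p n d rule: hit_prob.induct)
  case (1 p n)
  then show ?case using hit_prob_le_1 by simp
next
  case (3 p n d)
  then show ?case by (auto intro!: add_mono mult_left_mono)
qed auto

text \<open>Raising the weight from \<open>p\<close> to \<open>r\<close> shifts mass from target
  \<open>d + 2\<close> to the nearer target \<open>d\<close>, where the probability is at least as
  large. The induction hypothesis then replaces \<open>p\<close> by \<open>r\<close> in the
  remaining factors.\<close>

lemma hit_prob_mono:
  assumes "0 \<le> p" "p \<le> r" "r \<le> 1"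
  shows "hit_prob p n d \<le> hit_prob r n d"
  using assms
proof (induction p n d rule: hit_prob.induct)
  case (3 p n d)
  have le: "hit_prob p n (Suc (Suc d)) \<le> hit_prob p n d"
    using hit_prob_Suc_le[of p n d] hit_prob_Suc_le[of p n "Suc d"] "3.prems" by linarith
  have "hit_prob p (Suc n) (Suc d)
      = hit_prob p n (Suc (Suc d)) + p * (hit_prob p n d - hit_prob p n (Suc (Suc d)))"
    by (simp add: algebra_simps)
  also have "\<dots> \<le> hit_prob p n (Suc (Suc d)) + r * (hit_prob p n d - hit_prob p n (Suc (Suc d)))"
    using le "3.prems" by (intro add_left_mono mult_right_mono) auto
  also have "\<dots> = r * hit_prob p n d + (1 - r) * hit_prob p n (Suc (Suc d))"
    by (simp add: algebra_simps)
  also have "\<dots> \<le> hit_prob r (Suc n) (Suc d)"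
    using 3 by (auto intro!: add_mono mult_left_mono)
  finally show ?case .
qed auto

lemma hit_prob_eq_0: "n < d \<Longrightarrow> hit_prob p n d = 0"
  by (induction p n d rule: hit_prob.induct) auto

text \<open>Only the path going up \<open>d\<close> times succeeds: after a down step the target is
  too far for the steps left.\<close>

lemma hit_prob_self: "hit_prob p d d = p ^ d"
  by (induction d) (auto simp: hit_prob_eq_0)

section \<open>The ratio as a function of the hitting time, and its truncated mean\<close>

definition ratio_at :: "nat \<Rightarrow> nat \<Rightarrow> real" where
  "ratio_at d n = 1 / 2 + real d / (2 * real n)"

text \<open>The mean of \<open>R\<^sub>N / N\<close> on the event \<open>N \<le> m\<close>, after summation by parts. The junk value
  \<open>ratio_at d 0 = 1/2\<close> is harmless, since \<open>hit_prob p 0 d = 0\<close> for \<open>d > 0\<close>.\<close>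

definition truncated_mean :: "nat \<Rightarrow> real \<Rightarrow> nat \<Rightarrow> real" where
  "truncated_mean d p m = ratio_at d m * hit_prob p m d +
    (\<Sum>n<m. (ratio_at d n - ratio_at d (Suc n)) * hit_prob p n d)"

text \<open>All terms of the difference are nonnegative, and the one at \<open>n = d\<close> is
  kept. The bound is free of \<open>m\<close>, so strictness survives the limit.\<close>

lemma truncated_mean_diff_ge:
  assumes "0 < d" "0 \<le> p" "p \<le> r" "r \<le> 1" "d < m"
  shows "(ratio_at d d - ratio_at d (Suc d)) * (r ^ d - p ^ d)
    \<le> truncated_mean d r m - truncated_mean d p m"
proof -
  let ?t = "\<lambda>n. (ratio_at d n - ratio_at d (Suc n)) * (hit_prob r n d - hit_prob p n d)"
  have "0 \<le> ?t n" for n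
  proof (cases n)
    \<comment> \<open>The coefficient is negative at \<open>n = 0\<close>, but both hitting
      probabilities vanish there.\<close>
    case 0
    then show ?thesis using \<open>0 < d\<close> by (simp add: hit_prob_eq_0)
  next
    case (Suc k)
    have "ratio_at d (Suc n) \<le> ratio_at d n"
      unfolding ratio_at_def by (intro add_left_mono divide_left_mono) (auto simp: Suc)
    then show ?thesis using assms by (simp add: hit_prob_mono)
  qed
  then have "?t d \<le> (\<Sum>n<m. ?t n)"
    using \<open>d < m\<close> by (intro member_le_sum) auto
  moreover have "0 \<le> ratio_at d m * (hit_prob r m d - hit_prob p m d)"
    using assms by (intro mult_nonneg_nonneg) (auto simp: ratio_at_def hit_prob_mono)
  moreover have "truncated_mean d r m - truncated_mean d p m =
      ratio_at d m * (hit_prob r m d - hit_prob p m d) + (\<Sum>n<m. ?t n)"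
    by (simp add: truncated_mean_def right_diff_distrib sum_subtractf)
  ultimately show ?thesis by (simp add: hit_prob_self)
qed

section \<open>The law of the hitting time\<close>

text \<open>Serves twice: for partial sums of steps on \<open>M\<close>, and for sums of coordinates
  on a product space when independence is applied.\<close>

lemma measurable_int_sum_count_space:
  fixes f :: "nat \<Rightarrow> 'b \<Rightarrow> int"
  assumes "\<And>i. i < m \<Longrightarrow> f i \<in> N \<rightarrow>\<^sub>M count_space UNIV"
  shows "(\<lambda>x. \<Sum>i<m. f i x) \<in> N \<rightarrow>\<^sub>M count_space UNIV"
  using assms
proof (induction m)
  case (Suc m)
  have [measurable]: "(\<lambda>x. \<Sum>i<m. f i x) \<in> N \<rightarrow>\<^sub>M count_space UNIV" "f m \<in> N \<rightarrow>\<^sub>M count_space UNIV"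
    using Suc by auto
  show ?case by simp measurable
qed simp

text \<open>A finite infimum rules out the empty set, and a nonempty set of extended naturals
  contains its infimum.\<close>

lemma hitting_time_attained:
  assumes "hitting_time S d \<omega> = enat n"
  shows "S n \<omega> = int d"
proof -
  have "enat ` {n. S n \<omega> = int d} \<noteq> {}"
  proof
    assume "enat ` {n. S n \<omega> = int d} = {}"
    then show False using assms unfolding hitting_time_def Inf_enat_def by simp
  qed
  then have "hitting_time S d \<omega> \<in> enat ` {n. S n \<omega> = int d}"
    unfolding hitting_time_def Inf_enat_def by (metis LeastI_ex ex_in_conv)
  with assms show ?thesis by auto
qed

context simple_random_walk
begin

text \<open>The offset \<open>k\<close> is shifted by the induction on the first step.\<close>

definition hits :: "nat \<Rightarrow> nat \<Rightarrow> nat \<Rightarrow> 'a set" where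
  "hits k n d = {\<omega> \<in> space M. \<exists>m\<le>n. (\<Sum>i<m. step S (Suc (k + i)) \<omega>) = int d}"

lemma step_measurable [measurable]: "step S (Suc n) \<in> M \<rightarrow>\<^sub>M count_space UNIV"
  using indep_steps unfolding indep_vars_def by auto

lemma hits_measurable [measurable]: "hits k n d \<in> sets M"
proof -
  have [measurable]: "\<And>m. (\<lambda>\<omega>. \<Sum>i<m. step S (Suc (k + i)) \<omega>) \<in> M \<rightarrow>\<^sub>M count_space UNIV"
    by (rule measurable_int_sum_count_space) measurable
  show ?thesis unfolding hits_def by measurable
qed

lemma AE_step: "AE \<omega> in M. \<forall>n. step S (Suc n) \<omega> = 1 \<or> step S (Suc n) \<omega> = - 1"
  unfolding AE_all_countable
proof
  fix n
  have "prob ({\<omega> \<in> space M. step S (Suc n) \<omega> = 1} \<union> {\<omega> \<in> space M. step S (Suc n) \<omega> = - 1}) = 1"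
    using prob_up[of "Suc n"] prob_down[of "Suc n"] by (subst finite_measure_Union) auto
  then have "prob {\<omega> \<in> space M. step S (Suc n) \<omega> = 1 \<or> step S (Suc n) \<omega> = - 1} = 1"
    by (simp add: Collect_disj_eq[symmetric] conj_disj_distribL[symmetric])
  then show "AE \<omega> in M. step S (Suc n) \<omega> = 1 \<or> step S (Suc n) \<omega> = - 1"
    using prob_Collect_eq_1 by simp
qed

text \<open>\<open>hits (Suc k) n d\<close> depends only on the steps of index at least
  \<open>k + 2\<close>. Both events are therefore preimages \<open>A\<close>, \<open>B\<close> of
  cylinder events over disjoint index sets.\<close>

lemma prob_step_hits:
  "prob ({\<omega> \<in> space M. step S (Suc k) \<omega> = c} \<inter> hits (Suc k) n d)
    = prob {\<omega> \<in> space M. step S (Suc k) \<omega> = c} * prob (hits (Suc k) n d)"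
proof -
  let ?C = "\<lambda>_::nat. count_space (UNIV :: int set)"
  define J where "J = {k + 2..}"
  have iv: "indep_var (PiM {Suc k} ?C) (\<lambda>\<omega>. restrict (\<lambda>i. step S i \<omega>) {Suc k})
                 (PiM J ?C) (\<lambda>\<omega>. restrict (\<lambda>i. step S i \<omega>) J)"
    by (rule indep_var_restrict[OF indep_steps]) (auto simp: J_def)
  define A where "A = {x \<in> space (PiM {Suc k} ?C). x (Suc k) = c}"
  define B where "B = {x \<in> space (PiM J ?C). \<exists>m\<le>n. (\<Sum>i<m. x (Suc (Suc k + i))) = int d}"
  have A: "A \<in> sets (PiM {Suc k} ?C)" unfolding A_def by measurable
  have [measurable]: "\<And>m. (\<lambda>x. \<Sum>i<m. x (Suc (Suc k + i))) \<in> PiM J ?C \<rightarrow>\<^sub>M count_space UNIV"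
    by (rule measurable_int_sum_count_space, rule measurable_component_singleton) (auto simp: J_def)
  have B: "B \<in> sets (PiM J ?C)" unfolding B_def by measurable
  have J: "Suc (Suc (k + i)) \<in> J" for i by (auto simp: J_def)
  have "(\<lambda>\<omega>. restrict (\<lambda>i. step S i \<omega>) {Suc k}) -` A \<inter> space M = {\<omega> \<in> space M. step S (Suc k) \<omega> = c}"
    by (auto simp: A_def space_PiM)
  moreover have "(\<lambda>\<omega>. restrict (\<lambda>i. step S i \<omega>) J) -` B \<inter> space M = hits (Suc k) n d"
    by (auto simp: B_def hits_def space_PiM J)
  moreover have "(\<lambda>\<omega>. (restrict (\<lambda>i. step S i \<omega>) {Suc k}, restrict (\<lambda>i. step S i \<omega>) J)) -` (A \<times> B) \<inter> space M
     = ((\<lambda>\<omega>. restrict (\<lambda>i. step S i \<omega>) {Suc k}) -` A \<inter> space M) \<inter>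
       ((\<lambda>\<omega>. restrict (\<lambda>i. step S i \<omega>) J) -` B \<inter> space M)"
    by auto
  ultimately show ?thesis using indep_varD[OF iv A B] by simp
qed

text \<open>The target is positive, so the empty sum is no hit and the first step can be split off;
  it leaves the target \<open>d\<close> or \<open>d + 2\<close> for the walk with offset
  \<open>Suc k\<close>.\<close>

lemma hits_Suc_Suc_iff:
  assumes "\<omega> \<in> space M" "step S (Suc k) \<omega> = 1 \<or> step S (Suc k) \<omega> = - 1"
  shows "\<omega> \<in> hits k (Suc n) (Suc d) \<longleftrightarrow>
    \<omega> \<in> ({\<omega> \<in> space M. step S (Suc k) \<omega> = 1} \<inter> hits (Suc k) n d) \<union>
      ({\<omega> \<in> space M. step S (Suc k) \<omega> = - 1} \<inter> hits (Suc k) n (Suc (Suc d)))"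
proof -
  have ex: "(\<exists>m\<le>Suc n. (\<Sum>i<m. f i) = int (Suc d)) \<longleftrightarrow>
      (\<exists>m\<le>n. f 0 + (\<Sum>i<m. f (Suc i)) = int (Suc d))" for f :: "nat \<Rightarrow> int"
  proof
    assume "\<exists>m\<le>Suc n. (\<Sum>i<m. f i) = int (Suc d)"
    then obtain m where m: "m \<le> Suc n" "(\<Sum>i<m. f i) = int (Suc d)" by auto
    then obtain m' where "m = Suc m'" by (cases m) auto
    with m show "\<exists>m\<le>n. f 0 + (\<Sum>i<m. f (Suc i)) = int (Suc d)"
      by (auto simp: sum.lessThan_Suc_shift simp del: sum.lessThan_Suc)
  next
    assume "\<exists>m\<le>n. f 0 + (\<Sum>i<m. f (Suc i)) = int (Suc d)"
    then obtain m where m: "m \<le> n" "f 0 + (\<Sum>i<m. f (Suc i)) = int (Suc d)" by auto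
    then show "\<exists>m\<le>Suc n. (\<Sum>i<m. f i) = int (Suc d)"
      by (intro exI[of _ "Suc m"]) (simp add: sum.lessThan_Suc_shift del: sum.lessThan_Suc)
  qed
  have "\<omega> \<in> hits k (Suc n) (Suc d) \<longleftrightarrow>
      (\<exists>m\<le>n. step S (Suc k) \<omega> + (\<Sum>i<m. step S (Suc (Suc k + i)) \<omega>) = int (Suc d))"
    using assms(1) ex[of "\<lambda>i. step S (Suc (k + i)) \<omega>"] by (simp add: hits_def)
  moreover have "1 + s = int (Suc d) \<longleftrightarrow> s = int d" "- 1 + s = int (Suc d) \<longleftrightarrow> s = int (Suc (Suc d))"
    for s :: int
    by auto
  ultimately show ?thesis using assms by (elim disjE) (simp_all add: hits_def)
qed

text \<open>Almost surely the event splits into two disjoint parts according to the first step.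
  Independence gives the weights \<open>p\<close> and \<open>1 - p\<close>, and the induction
  hypothesis is used at offset \<open>Suc k\<close>.\<close>

lemma prob_hits: "prob (hits k n d) = hit_prob p n d"
proof (induction n arbitrary: k d)
  case 0
  show ?case by (cases d) (auto simp: hits_def prob_space)
next
  case (Suc n)
  show ?case
  proof (cases d)
    case 0
    have "hits k (Suc n) 0 = space M" by (auto simp: hits_def intro: exI[of _ 0])
    then show ?thesis by (simp add: prob_space 0)
  next
    case d: (Suc e)
    let ?up = "{\<omega> \<in> space M. step S (Suc k) \<omega> = 1}"
    let ?down = "{\<omega> \<in> space M. step S (Suc k) \<omega> = - 1}"
    have "AE \<omega> in M. \<omega> \<in> hits k (Suc n) (Suc e) \<longleftrightarrow>
        \<omega> \<in> (?up \<inter> hits (Suc k) n e) \<union> (?down \<inter> hits (Suc k) n (Suc (Suc e)))"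
      using AE_step by (rule AE_mp, intro AE_I2 impI hits_Suc_Suc_iff) auto
    then have "prob (hits k (Suc n) (Suc e)) =
        prob ((?up \<inter> hits (Suc k) n e) \<union> (?down \<inter> hits (Suc k) n (Suc (Suc e))))"
      by (rule measure_eq_AE) measurable
    also have "\<dots> = prob (?up \<inter> hits (Suc k) n e) + prob (?down \<inter> hits (Suc k) n (Suc (Suc e)))"
      by (rule finite_measure_Union) auto
    also have "\<dots> = hit_prob p (Suc n) (Suc e)"
      by (simp add: prob_step_hits Suc.IH prob_up prob_down)
    finally show ?thesis by (simp add: d)
  qed
qed

lemma sum_step: "\<omega> \<in> space M \<Longrightarrow> (\<Sum>i<n. step S (Suc i) \<omega>) = S n \<omega>"
  by (induction n) (auto simp: start step_def)

lemma hits_iff_hitting_time: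
  assumes "\<omega> \<in> space M"
  shows "\<omega> \<in> hits 0 m d \<longleftrightarrow> hitting_time S d \<omega> \<le> enat m"
proof -
  have "\<omega> \<in> hits 0 m d \<longleftrightarrow> (\<exists>n\<le>m. S n \<omega> = int d)"
    using assms by (simp add: hits_def sum_step)
  also have "\<dots> \<longleftrightarrow> hitting_time S d \<omega> \<le> enat m"
  proof
    assume "\<exists>n\<le>m. S n \<omega> = int d"
    then show "hitting_time S d \<omega> \<le> enat m"
      unfolding hitting_time_def by (auto intro: Inf_lower2)
  next
    assume *: "hitting_time S d \<omega> \<le> enat m"
    then show "\<exists>n\<le>m. S n \<omega> = int d"
      by (cases "hitting_time S d \<omega>") (auto dest: hitting_time_attained)
  qed
  finally show ?thesis .
qed

section \<open>Measurability and bounds\<close>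

text \<open>As \<open>enat\<close> is countable, preimages of points suffice, and these are Boolean
  combinations of the events N \<le> m.\<close>

lemma hitting_time_measurable [measurable]: "hitting_time S d \<in> M \<rightarrow>\<^sub>M count_space UNIV"
  unfolding measurable_count_space_eq2_countable
proof (intro conjI ballI)
  fix x :: enat
  show "hitting_time S d -` {x} \<inter> space M \<in> sets M"
  proof (cases x)
    case (enat n)
    have "hitting_time S d -` {x} \<inter> space M = hits 0 n d - (\<Union>m<n. hits 0 m d)"
    proof (intro set_eqI)
      fix \<omega>
      show "\<omega> \<in> hitting_time S d -` {x} \<inter> space M \<longleftrightarrow> \<omega> \<in> hits 0 n d - (\<Union>m<n. hits 0 m d)"
      proof (cases "\<omega> \<in> space M")
        case True
        then show ?thesis
          by (cases "hitting_time S d \<omega>") (auto simp: hits_iff_hitting_time enat not_le dest!: leI)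
      qed (auto simp: hits_def)
    qed
    then show ?thesis by simp
  next
    case infinity
    have "hitting_time S d -` {x} \<inter> space M = space M - (\<Union>m. hits 0 m d)"
    proof (intro set_eqI)
      fix \<omega>
      show "\<omega> \<in> hitting_time S d -` {x} \<inter> space M \<longleftrightarrow> \<omega> \<in> space M - (\<Union>m. hits 0 m d)"
        by (cases "hitting_time S d \<omega>") (auto simp: hits_iff_hitting_time infinity)
    qed
    then show ?thesis by simp
  qed
qed simp

lemma right_ratio_measurable [measurable]: "right_ratio S d \<in> borel_measurable M"
proof -
  have "{\<omega> \<in> space M. i \<in> {k \<in> {1..n}. step S k \<omega> = 1}} \<in> sets M" for i n
    \<comment> \<open>Measurability of \<open>step S i\<close> is known for positive
      \<open>i\<close>; for \<open>i = 0\<close> the set is empty.\<close>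
    by (cases i) auto
  then have [measurable]: "right_steps S n \<in> M \<rightarrow>\<^sub>M count_space UNIV" for n
    unfolding right_steps_def by (rule measurable_card)
  show ?thesis unfolding right_ratio_def by measurable
qed

lemma right_ratio_bounds: "0 \<le> right_ratio S d \<omega>" "right_ratio S d \<omega> \<le> 1"
proof -
  have "right_steps S n \<omega> \<le> n" for n
    using card_mono[OF finite_atLeastAtMost Collect_restrict, of 1 n] by (simp add: right_steps_def)
  then show "0 \<le> right_ratio S d \<omega>" "right_ratio S d \<omega> \<le> 1"
    \<comment> \<open>At \<open>n = 0\<close> the quotient is \<open>0 / 0 = 0\<close>, so the
      bounds hold at every point.\<close>
    by (auto simp: right_ratio_def divide_le_eq split: enat.split)
qed

section \<open>Pathwise summation by parts and the mean\<close>

text \<open>The position is the number of up steps minus the number of down steps, the latter being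
  \<open>n\<close> minus the former.\<close>

lemma walk_eq_right_steps:
  assumes "\<omega> \<in> space M" "\<forall>n. step S (Suc n) \<omega> = 1 \<or> step S (Suc n) \<omega> = - 1"
  shows "S n \<omega> = 2 * int (right_steps S n \<omega>) - int n"
proof (induction n)
  case 0
  then show ?case using assms by (simp add: start right_steps_def)
next
  case (Suc n)
  have "{k \<in> {1..Suc n}. step S k \<omega> = 1} =
      {k \<in> {1..n}. step S k \<omega> = 1} \<union> (if step S (Suc n) \<omega> = 1 then {Suc n} else {})"
    by (auto simp: le_Suc_eq)
  then have "right_steps S (Suc n) \<omega> = right_steps S n \<omega> + (if step S (Suc n) \<omega> = 1 then 1 else 0)"
    by (auto simp: right_steps_def)
  moreover have "S (Suc n) \<omega> = S n \<omega> + step S (Suc n) \<omega>"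
    by (simp add: step_def)
  ultimately show ?case using Suc assms(2)[rule_format, of n] by auto
qed

lemma right_ratio_hitting_time:
  assumes "\<omega> \<in> space M" "\<forall>n. step S (Suc n) \<omega> = 1 \<or> step S (Suc n) \<omega> = - 1"
    and N: "hitting_time S d \<omega> = enat n" and "0 < n"
  shows "right_ratio S d \<omega> = ratio_at d n"
proof -
  have "int d = 2 * int (right_steps S n \<omega>) - int n"
    using hitting_time_attained[OF N] walk_eq_right_steps[OF assms(1,2), of n] by auto
  then have "2 * real (right_steps S n \<omega>) = real d + real n"
    by linarith
  then show ?thesis
    using N \<open>0 < n\<close> by (simp add: right_ratio_def ratio_at_def field_simps)
qed

text \<open>The coefficients telescope from the hitting time up to \<open>m\<close>. In the
  induction step the target was hit by time \<open>m\<close>, is not hit by \<open>Suc m\<close>, or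
  is hit first at \<open>Suc m\<close>.\<close>

lemma truncated_right_ratio:
  assumes "\<omega> \<in> space M" "\<forall>n. step S (Suc n) \<omega> = 1 \<or> step S (Suc n) \<omega> = - 1" "0 < d"
  shows "right_ratio S d \<omega> * indicator (hits 0 m d) \<omega> =
    ratio_at d m * indicator (hits 0 m d) \<omega> +
    (\<Sum>n<m. (ratio_at d n - ratio_at d (Suc n)) * indicator (hits 0 n d) \<omega>)"
proof (induction m)
  case 0
  have "\<omega> \<notin> hits 0 0 d" using \<open>0 < d\<close> by (auto simp: hits_def)
  then show ?case by simp
next
  case (Suc m)
  have "\<omega> \<in> hits 0 m d \<or> \<omega> \<notin> hits 0 (Suc m) d \<or> hitting_time S d \<omega> = enat (Suc m)"
    using assms(1) by (cases "hitting_time S d \<omega>") (auto simp: hits_iff_hitting_time)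
  then consider "\<omega> \<in> hits 0 m d" | "\<omega> \<notin> hits 0 (Suc m) d" | "hitting_time S d \<omega> = enat (Suc m)"
    by blast
  moreover have mono: "\<omega> \<in> hits 0 m d \<Longrightarrow> \<omega> \<in> hits 0 (Suc m) d"
    using assms(1) by (auto simp: hits_def intro: le_SucI)
  ultimately show ?case
  proof cases
    case 1
    with mono Suc show ?thesis by simp
  next
    case 2
    with mono have "\<omega> \<notin> hits 0 m d" by blast
    with 2 Suc show ?thesis by simp
  next
    case 3
    then have "\<omega> \<notin> hits 0 m d" "\<omega> \<in> hits 0 (Suc m) d"
      using assms(1) by (auto simp: hits_iff_hitting_time)
    moreover have "right_ratio S d \<omega> = ratio_at d (Suc m)"
      using right_ratio_hitting_time[OF assms(1,2) 3] by simp
    ultimately show ?thesis using Suc by simp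
  qed
qed

text \<open>Integrating the pathwise identity turns each indicator into a \<open>hit_prob\<close>,
  so the truncated mean depends on the walk through \<open>p\<close> alone.\<close>

lemma expectation_truncated_right_ratio:
  assumes "0 < d"
  shows "expectation (\<lambda>\<omega>. right_ratio S d \<omega> * indicator (hits 0 m d) \<omega>) = truncated_mean d p m"
proof -
  have int: "integrable M (\<lambda>\<omega>. c * indicator (hits 0 n d) \<omega> :: real)" for c n
    by (intro integrable_mult_right integrable_real_indicator) (auto simp: emeasure_eq_measure)
  have "expectation (\<lambda>\<omega>. right_ratio S d \<omega> * indicator (hits 0 m d) \<omega>) =
      expectation (\<lambda>\<omega>. ratio_at d m * indicator (hits 0 m d) \<omega> +
        (\<Sum>n<m. (ratio_at d n - ratio_at d (Suc n)) * indicator (hits 0 n d) \<omega>))"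
  proof (rule integral_cong_AE)
    show "AE \<omega> in M. right_ratio S d \<omega> * indicator (hits 0 m d) \<omega> =
        ratio_at d m * indicator (hits 0 m d) \<omega> +
        (\<Sum>n<m. (ratio_at d n - ratio_at d (Suc n)) * indicator (hits 0 n d) \<omega>)"
      using AE_step by (rule AE_mp, intro AE_I2 impI truncated_right_ratio assms) auto
  qed measurable
  also have "\<dots> = truncated_mean d p m"
    unfolding truncated_mean_def
    by (subst Bochner_Integration.integral_add Bochner_Integration.integral_sum,
        (intro int Bochner_Integration.integrable_sum)+)+ (simp add: prob_hits)
  finally show ?thesis .
qed

text \<open>Dominated convergence with bound 1; on a path that hits the target the truncation is
  eventually void.\<close>

lemma truncated_mean_tendsto:
  assumes "0 < d"
  shows "truncated_mean d p \<longlonglongrightarrow> expectation (right_ratio S d)"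
proof -
  have "(\<lambda>m. expectation (\<lambda>\<omega>. right_ratio S d \<omega> * indicator (hits 0 m d) \<omega>))
      \<longlonglongrightarrow> expectation (right_ratio S d)"
  proof (rule integral_dominated_convergence[where w = "\<lambda>_. 1"])
    show "AE \<omega> in M. (\<lambda>m. right_ratio S d \<omega> * indicator (hits 0 m d) \<omega>) \<longlonglongrightarrow> right_ratio S d \<omega>"
    proof (rule AE_I2)
      fix \<omega> assume \<omega>: "\<omega> \<in> space M"
      show "(\<lambda>m. right_ratio S d \<omega> * indicator (hits 0 m d) \<omega>) \<longlonglongrightarrow> right_ratio S d \<omega>"
      proof (cases "hitting_time S d \<omega>")
        case (enat n)
        have "eventually (\<lambda>m. right_ratio S d \<omega> * indicator (hits 0 m d) \<omega> = right_ratio S d \<omega>) sequentially"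
          using eventually_ge_at_top[of n]
          by eventually_elim (use \<omega> enat in \<open>simp add: hits_iff_hitting_time\<close>)
        then show ?thesis by (rule tendsto_eventually)
      next
        case infinity
        \<comment> \<open>The default value 0 of \<open>right_ratio\<close> makes all truncated
          terms equal to the limit.\<close>
        then show ?thesis by (simp add: right_ratio_def)
      qed
    qed
    show "AE \<omega> in M. norm (right_ratio S d \<omega> * indicator (hits 0 m d) \<omega>) \<le> 1" for m
      using right_ratio_bounds by (auto simp: indicator_def)
  qed measurable
  then show ?thesis by (simp add: expectation_truncated_right_ratio assms)
qed

section \<open>Bounds on the mean and the variance\<close>

lemma integrable_right_ratio: "integrable M (right_ratio S d)"
  by (rule integrable_const_bound[of _ 1]) (auto simp: right_ratio_bounds)

lemma expectation_right_ratio_le_1: "expectation (right_ratio S d) \<le> 1"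
  using integral_mono[OF integrable_right_ratio, of "\<lambda>_. 1" d] right_ratio_bounds by (simp add: prob_space)

text \<open>Truncation at time \<open>d\<close> keeps only the paths that go straight up, on which
  the ratio is \<open>ratio_at d d = 1\<close>.\<close>

lemma expectation_right_ratio_ge:
  assumes "0 < d"
  shows "p ^ d \<le> expectation (right_ratio S d)"
proof -
  have "p ^ d = truncated_mean d p d"
    using assms by (simp add: truncated_mean_def hit_prob_self hit_prob_eq_0 ratio_at_def)
  also have "\<dots> = expectation (\<lambda>\<omega>. right_ratio S d \<omega> * indicator (hits 0 d d) \<omega>)"
    by (simp add: expectation_truncated_right_ratio assms)
  also have "\<dots> \<le> expectation (right_ratio S d)"
    by (intro integral_mono' integrable_right_ratio) (auto simp: indicator_def right_ratio_bounds)
  finally show ?thesis .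
qed

text \<open>A variable with values in [0, 1] dominates its square.\<close>

lemma variance_right_ratio_le:
  "variance (right_ratio S d) \<le> expectation (right_ratio S d) - (expectation (right_ratio S d))\<^sup>2"
proof -
  have sq: "(right_ratio S d \<omega>)\<^sup>2 \<le> right_ratio S d \<omega>" for \<omega>
    using right_ratio_bounds[of d \<omega>] by (simp add: power2_eq_square mult_left_le)
  have int: "integrable M (\<lambda>\<omega>. (right_ratio S d \<omega>)\<^sup>2)"
    by (rule integrable_const_bound[of _ 1]) (auto simp: right_ratio_bounds power_le_one)
  show ?thesis
    using integral_mono[OF int integrable_right_ratio sq] variance_eq[OF integrable_right_ratio int]
    by simp
qed

end

section \<open>Strict monotonicity and the limits at 1\<close>

theorem corollary2p3:
  fixes d :: nat
    and M :: "real \<Rightarrow> 'a measure"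
    and S :: "real \<Rightarrow> nat \<Rightarrow> 'a \<Rightarrow> int"
  assumes "d > 0"
    and "\<And>p. p \<in> {1/2..1} \<Longrightarrow> simple_random_walk (M p) p (S p)"
  shows "strict_mono_on {1/2..1} (\<lambda>p. prob_space.expectation (M p) (right_ratio (S p) d))
    \<and> ((\<lambda>p. prob_space.expectation (M p) (right_ratio (S p) d)) \<longlongrightarrow> 1) (at_left 1)
    \<and> ((\<lambda>p. prob_space.variance (M p) (right_ratio (S p) d)) \<longlongrightarrow> 0) (at_left 1)"
proof (intro conjI)
  let ?E = "\<lambda>p. prob_space.expectation (M p) (right_ratio (S p) d)"
  let ?V = "\<lambda>p. prob_space.variance (M p) (right_ratio (S p) d)"
  note rw = assms(2)
  show "strict_mono_on {1/2..1} ?E"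
  proof (rule strict_mono_onI)
    fix p r :: real assume p: "p \<in> {1/2..1}" and r: "r \<in> {1/2..1}" and "p < r"
    have "(\<lambda>m. truncated_mean d r m - truncated_mean d p m) \<longlonglongrightarrow> ?E r - ?E p"
      by (intro tendsto_diff simple_random_walk.truncated_mean_tendsto rw p r assms(1))
    \<comment> \<open>From \<open>m = Suc d\<close> on, the sum contains the strict term
      \<open>n = d\<close>.\<close>
    moreover have "\<forall>m\<ge>Suc d. (ratio_at d d - ratio_at d (Suc d)) * (r ^ d - p ^ d)
        \<le> truncated_mean d r m - truncated_mean d p m"
      using truncated_mean_diff_ge[OF assms(1), of p r] p r \<open>p < r\<close> by auto
    ultimately have "(ratio_at d d - ratio_at d (Suc d)) * (r ^ d - p ^ d) \<le> ?E r - ?E p"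
      by (intro LIMSEQ_le_const) auto
    moreover have "0 < (ratio_at d d - ratio_at d (Suc d)) * (r ^ d - p ^ d)"
    proof (rule mult_pos_pos)
      \<comment> \<open>The difference equals 1 / (2 (d + 1)).\<close>
      show "0 < ratio_at d d - ratio_at d (Suc d)"
        using assms(1) by (simp add: ratio_at_def field_simps)
      show "0 < r ^ d - p ^ d"
        using p \<open>p < r\<close> assms(1) by (simp add: power_strict_mono)
    qed
    ultimately show "?E p < ?E r" by linarith
  qed
  \<comment> \<open>The walks are given for \<open>p\<close> in [1/2, 1], which contains a left
    neighbourhood of 1.\<close>
  have near_1: "eventually (\<lambda>p::real. p \<in> {1/2..1}) (at_left 1)"
    using eventually_at_left_real[of "1/2" 1] by (auto elim: eventually_mono)
  have pow: "((\<lambda>p. p ^ d) \<longlongrightarrow> 1) (at_left (1::real))"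
    by (auto intro!: tendsto_eq_intros)
  show E: "(?E \<longlongrightarrow> 1) (at_left 1)"
  proof (rule tendsto_sandwich[OF _ _ pow tendsto_const])
    show "eventually (\<lambda>p. p ^ d \<le> ?E p) (at_left 1)"
      using near_1
      by eventually_elim (intro simple_random_walk.expectation_right_ratio_ge rw assms(1))
    show "eventually (\<lambda>p. ?E p \<le> 1) (at_left 1)"
      using near_1
      by eventually_elim (rule simple_random_walk.expectation_right_ratio_le_1[OF rw])
  qed
  have E2: "((\<lambda>p. ?E p - (?E p)\<^sup>2) \<longlongrightarrow> 0) (at_left 1)"
    using tendsto_diff[OF E tendsto_power[OF E, of 2]] by simp
  show "(?V \<longlongrightarrow> 0) (at_left 1)"
  proof (rule tendsto_sandwich[OF _ _ tendsto_const E2])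
    show "eventually (\<lambda>p. 0 \<le> ?V p) (at_left 1)"
      by (auto intro!: always_eventually integral_nonneg_AE)
    show "eventually (\<lambda>p. ?V p \<le> ?E p - (?E p)\<^sup>2) (at_left 1)"
      using near_1
      by eventually_elim (rule simple_random_walk.variance_right_ratio_le[OF rw])
  qed
qed

end
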